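(* We have $$\sum_{\pi\in\overline{\mathcal P}}y^{e(\pi)}z^{o(\pi)}q^{|\pi|}=\frac{\mathcal J(y,z;q)}{\mathcal J(-y,-z;q)},$$ where $\overline{\mathcal P}$ is the set of all overpartitions, $e(\pi)$ and $o(\pi)$ are the numbers of even and odd parts of $\pi$, and $\mathcal J(y,z;q)=\sum_{\lambda}y^{r(\lambda)}z^{s(\lambda)}q^{|\lambda|}$, the sum being over all integer partitions $\lambda$.
   Context: An overpartition is a partition in which the first occurrence of each distinct part may be overlined. For an overpartition $\pi$, $e(\pi)$ and $o(\pi)$ count even and odd parts with multiplicity and independently of overlining. For an integer partition $\lambda$, let $r(\lambda)$ be the largest part size of multiplicity at least $2$ ($r(\lambda)=0$ if $\lambda$ has distinct parts). Let $u_1>u_2>\cdots$ be the part sizes occurring with odd multiplicity, each taken once (the unpaired parts left after pairing equal parts as far as possible), and let $s(\lambda)=u_1-u_2+u_3-u_4+\cdots$ ($0$ if there are none). The identity is between formal power series in $q$ with coefficients polynomial in $y,z$. *)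

theory Defs
  imports "HOL-Library.Multiset" "HOL-Computational_Algebra.Computational_Algebra"
begin

text \<open>An integer partition is the multiset of its (positive) parts.\<close>

definition partitions_of :: "nat \<Rightarrow> nat multiset set" where
  "partitions_of n = {p. 0 \<notin># p \<and> sum_mset p = n}"

text \<open>An overpartition is encoded as a pair \<open>(p, S)\<close>: \<open>p\<close> is the underlying partition, and
  \<open>S\<close> is the set of those part sizes whose first occurrence is overlined.\<close>

definition overpartitions_of :: "nat \<Rightarrow> (nat multiset \<times> nat set) set" where
  "overpartitions_of n = {(p, S). p \<in> partitions_of n \<and> S \<subseteq> set_mset p}"

fun even_parts :: "nat multiset \<times> nat set \<Rightarrow> nat" where
  "even_parts (p, S) = size (filter_mset even p)"

fun odd_parts :: "nat multiset \<times> nat set \<Rightarrow> nat" where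
  "odd_parts (p, S) = size (filter_mset odd p)"

definition largest_repeated :: "nat multiset \<Rightarrow> nat" where
  "largest_repeated p =
    (if \<exists>k. count p k \<ge> 2 then Max {k. count p k \<ge> 2} else 0)"

text \<open>The part sizes \<open>u\<^sub>1 > u\<^sub>2 > \<dots>\<close> occurring with odd multiplicity, in decreasing order.\<close>

definition unpaired_parts :: "nat multiset \<Rightarrow> nat list" where
  "unpaired_parts p = rev (sorted_list_of_set {k. odd (count p k)})"

text \<open>List positions start at \<open>0\<close>, so \<open>u\<^sub>1\<close> gets the sign \<open>+\<close>. The alternating sum of a decreasing
  sequence of naturals is nonnegative, so \<^const>\<open>nat\<close> does not truncate
  (see \<open>int_alternating_unpaired\<close> below).\<close>

definition alternating_unpaired :: "nat multiset \<Rightarrow> nat" where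
  "alternating_unpaired p =
    nat (\<Sum>i<length (unpaired_parts p). (-1) ^ i * int (unpaired_parts p ! i))"

text \<open>The variable \<open>q\<close> is the power series variable: the coefficient of \<open>q ^ n\<close> sums over the
  finitely many (over)partitions of \<open>n\<close>.\<close>

definition overpartition_series :: "'a::comm_ring_1 \<Rightarrow> 'a \<Rightarrow> 'a fps" where
  "overpartition_series y z =
    Abs_fps (\<lambda>n. \<Sum>\<pi>\<in>overpartitions_of n. y ^ even_parts \<pi> * z ^ odd_parts \<pi>)"

definition J_series :: "'a::comm_ring_1 \<Rightarrow> 'a \<Rightarrow> 'a fps" where
  "J_series y z =
    Abs_fps (\<lambda>n. \<Sum>p\<in>partitions_of n. y ^ largest_repeated p * z ^ alternating_unpaired p)"

text \<open>The indeterminates of the polynomial ring \<open>\<int>[z][y]\<close>.\<close>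

definition Y_var :: "int poly poly" where "Y_var = [:0, 1:]"

definition Z_var :: "int poly poly" where "Z_var = [:[:0, 1:]:]"

text \<open>The following facts confirm that no sum, maximum or list above is taken over an infinite
  set, and that the alternating sum is never negative.\<close>

lemma finite_partitions_of: "finite (partitions_of n)"
proof -
  have "partitions_of n \<subseteq> mset ` {xs. set xs \<subseteq> {..n} \<and> length xs \<le> n}"
  proof
    fix p assume p: "p \<in> partitions_of n"
    obtain xs where xs: "mset xs = p" using ex_mset by blast
    have 0: "0 \<notin> set xs" and s: "sum_list xs = n"
      using p xs by (auto simp: partitions_of_def sum_mset_sum_list[symmetric])
    have "set xs \<subseteq> {..n}" using s member_le_sum_list by auto
    moreover have "length ys \<le> sum_list ys" if "0 \<notin> set ys" for ys :: "nat list"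
      using that by (induction ys) auto
    then have "length xs \<le> n" using 0 s by blast
    ultimately show "p \<in> mset ` {xs. set xs \<subseteq> {..n} \<and> length xs \<le> n}" using xs by auto
  qed
  then show ?thesis
    using finite_lists_length_le[of "{..n}" n] by (metis finite_atMost finite_imageI finite_subset)
qed

lemma finite_overpartitions_of: "finite (overpartitions_of n)"
proof -
  have "overpartitions_of n = (SIGMA p:partitions_of n. Pow (set_mset p))"
    by (auto simp: overpartitions_of_def)
  then show ?thesis by (simp add: finite_partitions_of)
qed

lemma finite_repeated: "finite {k. count p k \<ge> 2}"
proof (rule finite_subset)
  show "{k. count p k \<ge> 2} \<subseteq> set_mset p"
  proof
    fix k assume "k \<in> {k. count p k \<ge> 2}"
    then have "count p k > 0" by (simp del: count_greater_zero_iff)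
    then show "k \<in> set_mset p" by (simp only: count_greater_zero_iff)
  qed
qed simp

lemma finite_unpaired: "finite {k. odd (count p k)}"
proof (rule finite_subset)
  show "{k. odd (count p k)} \<subseteq> set_mset p"
  proof
    fix k assume "k \<in> {k. odd (count p k)}"
    then have "count p k > 0" by (simp add: odd_pos del: count_greater_zero_iff)
    then show "k \<in> set_mset p" by (simp only: count_greater_zero_iff)
  qed
qed simp

lemma alternating_sum_bounds:
  fixes xs :: "nat list"
  assumes "sorted_wrt (\<ge>) xs"
  shows "0 \<le> (\<Sum>i<length xs. (-1) ^ i * int (xs ! i)) \<and>
    (xs \<noteq> [] \<longrightarrow> (\<Sum>i<length xs. (-1) ^ i * int (xs ! i)) \<le> int (hd xs))"
  using assms
proof (induction xs)
  case (Cons x xs)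
  have eq: "(\<Sum>i<length (x # xs). (-1) ^ i * int ((x # xs) ! i)) =
      int x - (\<Sum>i<length xs. (-1) ^ i * int (xs ! i))"
    unfolding length_Cons sum.lessThan_Suc_shift by (simp add: sum_negf)
  have "xs \<noteq> [] \<Longrightarrow> hd xs \<le> x" using Cons.prems by simp
  moreover have "0 \<le> (\<Sum>i<length xs. (-1) ^ i * int (xs ! i)) \<and>
      (xs \<noteq> [] \<longrightarrow> (\<Sum>i<length xs. (-1) ^ i * int (xs ! i)) \<le> int (hd xs))"
    using Cons by simp
  ultimately show ?case unfolding eq by (cases "xs = []") auto
qed simp

lemma int_alternating_unpaired:
  "int (alternating_unpaired p) =
    (\<Sum>i<length (unpaired_parts p). (-1) ^ i * int (unpaired_parts p ! i))"
proof -
  have "sorted_wrt (\<ge>) (unpaired_parts p)"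
    by (simp add: unpaired_parts_def sorted_wrt_rev)
  from alternating_sum_bounds[OF this] show ?thesis
    by (simp add: alternating_unpaired_def)
qed

end

(* Write w(k) = y for even k and z for odd k, and let G(w) and D(w) be the generating functions of
   all partitions and of all finite sets of positive integers, a part k having weight w(k) q^k.
   Splitting off the overlined parts shows that overpartitions have generating function G(w) D(w),
   and G(-w) D(w) = 1 because the subsets S of a nonempty set cancel under the sign (-1)^|S|. So
   D(w) inverts G(-w), and it remains to see that J(y, z; q) = G(w).

   Pairing equal parts writes a partition as p + p + U with U a set; then r is the largest part
   of p and s is the alternating sum of U, so J factors. Trading the largest part for the number
   of parts turns the p-factor into the partitions into even parts. For the U-factor, subtracting
   1 from all elements of an m-element set gives a recursion in m, whose solution
   is the Durfee-square expansion of the product over odd parts. The latter is evaluated by letting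
   the width of the Durfee rectangles tend to infinity, the sum being independent of it. *)

theory Submission
  imports Defs
begin

section \<open>Generating functions of graded sets\<close>

text \<open>A sum over an infinite set is 0 by default, so the coefficients are sure to be the
  intended ones only for \<open>graded\<close> sets.\<close>

definition gf :: "('s \<Rightarrow> nat) \<Rightarrow> ('s \<Rightarrow> 'a::comm_ring_1) \<Rightarrow> 's set \<Rightarrow> 'a fps" where
  "gf sz wt S = Abs_fps (\<lambda>n. \<Sum>s\<in>{s \<in> S. sz s = n}. wt s)"

definition graded :: "('s \<Rightarrow> nat) \<Rightarrow> 's set \<Rightarrow> bool" where
  "graded sz S \<longleftrightarrow> (\<forall>n. finite {s \<in> S. sz s = n})"

lemma gf_nth: "gf sz wt S $ n = (\<Sum>s\<in>{s \<in> S. sz s = n}. wt s)"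
  by (simp add: gf_def)

lemma gradedD: "graded sz S \<Longrightarrow> finite {s \<in> S. sz s = n}"
  by (simp add: graded_def)

lemma graded_subset: "graded sz T \<Longrightarrow> S \<subseteq> T \<Longrightarrow> graded sz S"
  unfolding graded_def
proof
  fix n assume "\<forall>n. finite {s \<in> T. sz s = n}" "S \<subseteq> T"
  then show "finite {s \<in> S. sz s = n}"
    by (intro finite_subset[of "{s \<in> S. sz s = n}" "{s \<in> T. sz s = n}"]) auto
qed

lemma gf_union:
  assumes "graded sz S" "graded sz T" "S \<inter> T = {}"
  shows "gf sz wt (S \<union> T) = gf sz wt S + gf sz wt T"
proof (rule fps_ext)
  fix n
  have "{s \<in> S \<union> T. sz s = n} = {s \<in> S. sz s = n} \<union> {s \<in> T. sz s = n}" by auto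
  moreover have "{s \<in> S. sz s = n} \<inter> {s \<in> T. sz s = n} = {}" using assms(3) by auto
  ultimately show "gf sz wt (S \<union> T) $ n = (gf sz wt S + gf sz wt T) $ n"
    using sum.union_disjoint[OF gradedD[OF assms(1)] gradedD[OF assms(2)]]
    by (simp only: gf_nth fps_add_nth)
qed

lemma gf_shift:
  assumes "inj_on f S"
    and "\<And>s. s \<in> S \<Longrightarrow> sz' (f s) = sz s + d"
    and "\<And>s. s \<in> S \<Longrightarrow> wt' (f s) = c * wt s"
  shows "gf sz' wt' (f ` S) = fps_const c * fps_X ^ d * gf sz wt S"
proof (rule fps_ext)
  fix n
  have *: "(fps_const c * fps_X ^ d * gf sz wt S) $ n = (if n < d then 0 else c * gf sz wt S $ (n - d))"
    by (simp add: mult.assoc fps_X_power_mult_nth)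
  show "gf sz' wt' (f ` S) $ n = (fps_const c * fps_X ^ d * gf sz wt S) $ n"
  proof (cases "n < d")
    case True
    then have "{s \<in> f ` S. sz' s = n} = {}" using assms(2) by auto
    then show ?thesis using True unfolding * by (simp only: gf_nth) simp
  next
    case False
    then have eq: "{s \<in> f ` S. sz' s = n} = f ` {s \<in> S. sz s = n - d}" using assms(2) by force
    have inj: "inj_on f {s \<in> S. sz s = n - d}" using assms(1) by (rule inj_on_subset) auto
    show ?thesis using False assms(3) unfolding *
      by (simp add: gf_nth eq sum.reindex[OF inj] sum_distrib_left)
  qed
qed

lemma gf_bij:
  assumes "bij_betw f S T"
    and "\<And>s. s \<in> S \<Longrightarrow> sz' (f s) = sz s"
    and "\<And>s. s \<in> S \<Longrightarrow> wt' (f s) = wt s"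
  shows "gf sz' wt' T = gf sz wt S"
  using gf_shift[of f S sz' sz 0 wt' 1 wt] assms by (simp add: bij_betw_def)

lemma gf_times:
  assumes "graded sz S" "graded sz' T"
  shows "gf sz wt S * gf sz' wt' T =
    gf (\<lambda>(s, t). sz s + sz' t) (\<lambda>(s, t). wt s * wt' t) (S \<times> T)"
proof (rule fps_ext)
  fix n
  let ?L = "\<lambda>i. {s \<in> S. sz s = i} \<times> {t \<in> T. sz' t = n - i}"
  have eq: "{p \<in> S \<times> T. (case p of (s, t) \<Rightarrow> sz s + sz' t) = n} = (\<Union>i\<in>{0..n}. ?L i)"
    by auto
  have "(gf sz wt S * gf sz' wt' T) $ n = (\<Sum>i=0..n. \<Sum>(s, t)\<in>?L i. wt s * wt' t)"
    by (simp add: fps_mult_nth gf_nth sum_product sum.cartesian_product)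
  also have "\<dots> = (\<Sum>(s, t)\<in>(\<Union>i\<in>{0..n}. ?L i). wt s * wt' t)"
    by (rule sum.UNION_disjoint[symmetric]) (use assms in \<open>auto simp: gradedD\<close>)
  finally show "(gf sz wt S * gf sz' wt' T) $ n =
      gf (\<lambda>(s, t). sz s + sz' t) (\<lambda>(s, t). wt s * wt' t) (S \<times> T) $ n"
    by (simp only: gf_nth eq)
qed

text \<open>An index may take infinitely many values on S but only finitely many at size n.
  Splitting by it one coefficient at a time avoids infinite sums of series.\<close>

lemma gf_nth_by_index:
  assumes "graded sz S" "finite K" "\<And>s. s \<in> S \<Longrightarrow> sz s = n \<Longrightarrow> idx s \<in> K"
  shows "gf sz wt S $ n = (\<Sum>k\<in>K. gf sz wt {s \<in> S. idx s = k} $ n)"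
proof -
  have "(\<Sum>k\<in>K. sum wt {s \<in> {s \<in> S. sz s = n}. idx s = k}) = sum wt {s \<in> S. sz s = n}"
    by (rule sum.group) (use assms in \<open>auto simp: gradedD\<close>)
  moreover have "{s \<in> {s \<in> S. sz s = n}. idx s = k} = {s \<in> {s \<in> S. idx s = k}. sz s = n}" for k
    by auto
  ultimately show ?thesis by (simp only: gf_nth)
qed

lemma gf_eq_by_index:
  assumes "graded sz S" "graded sz' S'"
    and "\<And>k. gf sz wt {s \<in> S. idx s = k} = gf sz' wt' {s \<in> S'. idx' s = k}"
  shows "gf sz wt S = gf sz' wt' S'"
proof (rule fps_ext)
  fix n
  \<comment> \<open>Both slices of size n are finite, so one finite index set serves both
    sides.\<close>
  let ?K = "idx ` {s \<in> S. sz s = n} \<union> idx' ` {s \<in> S'. sz' s = n}"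
  have "finite ?K" using assms(1,2) by (simp add: gradedD)
  then show "gf sz wt S $ n = gf sz' wt' S' $ n"
    by (simp only: assms(3) gf_nth_by_index[OF assms(1), of ?K n idx] gf_nth_by_index[OF assms(2), of ?K n idx']
        UnI1 UnI2 imageI mem_Collect_eq)
qed

lemma gf_singleton: "gf sz wt {s} = fps_const (wt s) * fps_X ^ sz s"
proof (rule fps_ext)
  fix n
  have "{t \<in> {s}. sz t = n} = (if sz s = n then {s} else {})" by auto
  then show "gf sz wt {s} $ n = (fps_const (wt s) * fps_X ^ sz s) $ n"
    by (auto simp: gf_nth)
qed

text \<open>The series 1/(1 - c q^n) for n > 0, as the right inverse grown from the constant term 1,
  so that coefficients from any commutative ring are allowed.\<close>

definition geometric :: "'a::comm_ring_1 \<Rightarrow> nat \<Rightarrow> 'a fps" where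
  "geometric c n = fps_right_inverse (1 - fps_const c * fps_X ^ n) 1"

lemma geometric: "n > 0 \<Longrightarrow> (1 - fps_const c * fps_X ^ n) * geometric c n = 1"
  unfolding geometric_def by (rule fps_right_inverse) (simp add: fps_mult_nth)

lemma geometric_solve:
  assumes "n > 0"
  shows "(1 - fps_const c * fps_X ^ n) * f = g \<longleftrightarrow> f = geometric c n * g"
proof -
  have "geometric c n * ((1 - fps_const c * fps_X ^ n) * h) = h"
    "(1 - fps_const c * fps_X ^ n) * (geometric c n * h) = h" for h
    using geometric[OF assms, of c] by (simp_all only: mult.left_commute mult.assoc[symmetric]
      mult.commute[of "geometric c n"] mult_1 mult_1_right)
  then show ?thesis by metis
qed

text \<open>The form in which geometric factors arise: an object counted by f is either primitive,
  hence counted by g, or comes from another object counted by f through a move that costs c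
  q^n.\<close>

lemma geometric_fixpoint:
  assumes "n > 0" "f = g + fps_const c * fps_X ^ n * f"
  shows "f = geometric c n * g"
proof -
  have "(1 - fps_const c * fps_X ^ n) * f = g"
    using assms(2) by (simp add: algebra_simps)
  then show ?thesis using geometric_solve[OF assms(1)] by blast
qed

section \<open>Weighted partitions\<close>

abbreviation weight :: "(nat \<Rightarrow> 'a::comm_ring_1) \<Rightarrow> nat multiset \<Rightarrow> 'a" where
  "weight w p \<equiv> prod_mset (image_mset w p)"

definition parts_in :: "nat set \<Rightarrow> nat multiset set" where
  "parts_in A = {p. set_mset p \<subseteq> A}"

abbreviation partitions :: "nat multiset set" where
  "partitions \<equiv> {p. 0 \<notin># p}"

definition partition_gf :: "(nat \<Rightarrow> 'a::comm_ring_1) \<Rightarrow> nat set \<Rightarrow> 'a fps" where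
  "partition_gf w A = gf sum_mset (weight w) (parts_in A)"

abbreviation positive_sets :: "nat set set" where
  "positive_sets \<equiv> {U. finite U \<and> 0 \<notin> U}"

definition distinct_gf :: "(nat \<Rightarrow> 'a::comm_ring_1) \<Rightarrow> 'a fps" where
  "distinct_gf w = gf \<Sum> (prod w) positive_sets"

lemma partitions_of_eq: "partitions_of n = {p \<in> partitions. sum_mset p = n}"
  by (auto simp: partitions_of_def)

lemma partitions_eq: "partitions = parts_in {0<..}"
  by (auto simp: parts_in_def) (metis gr0I)

lemma graded_partitions: "graded sum_mset partitions"
  using finite_partitions_of by (simp add: graded_def partitions_of_eq)

lemma graded_parts_in: "0 \<notin> A \<Longrightarrow> graded sum_mset (parts_in A)"
  by (rule graded_subset[OF graded_partitions]) (auto simp: parts_in_def)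

lemma graded_partitions_double: "graded (\<lambda>p. 2 * sum_mset p) partitions"
  unfolding graded_def
proof
  fix n
  have "{p \<in> partitions. 2 * sum_mset p = n} \<subseteq> {p \<in> partitions. sum_mset p = n div 2}" by auto
  then show "finite {p \<in> partitions. 2 * sum_mset p = n}"
    using finite_subset gradedD[OF graded_partitions] by blast
qed

lemma graded_finite_sets: "graded \<Sum> {V :: nat set. finite V}"
  unfolding graded_def
proof
  fix n :: nat
  have "x \<le> n" if "finite V" "\<Sum> V = n" "x \<in> V" for x V
    using member_le_sum[of x V "\<lambda>x. x"] that by simp
  then have "{V \<in> {V. finite V}. \<Sum> V = n} \<subseteq> Pow {..n}" by auto
  then show "finite {V \<in> {V. finite V}. \<Sum> V = n}" by (rule finite_subset) simp
qed

lemma graded_positive_sets: "graded \<Sum> positive_sets"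
  by (rule graded_subset[OF graded_finite_sets]) auto

text \<open>Either k does not occur, or one copy of k can be removed without leaving the class. This
  is the fixpoint equation of a geometric factor.\<close>

lemma partition_gf_insert:
  assumes "k \<notin> A" "0 \<notin> A" "k > 0"
  shows "partition_gf w (insert k A) = geometric (w k) k * partition_gf w A"
proof -
  have eq: "parts_in (insert k A) = parts_in A \<union> add_mset k ` parts_in (insert k A)"
  proof (intro equalityI subsetI)
    fix p assume p: "p \<in> parts_in (insert k A)"
    show "p \<in> parts_in A \<union> add_mset k ` parts_in (insert k A)"
    proof (cases "k \<in># p")
      case True
      then obtain q where "p = add_mset k q" using multi_member_split by metis
      then show ?thesis using p by (auto simp: parts_in_def)
    qed (use p in \<open>auto simp: parts_in_def\<close>)
  qed (auto simp: parts_in_def)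
  have "partition_gf w (insert k A) = partition_gf w A + gf sum_mset (weight w) (add_mset k ` parts_in (insert k A))"
    unfolding partition_gf_def
    by (subst eq, rule gf_union, rule graded_parts_in[OF assms(2)],
        rule graded_subset[OF graded_partitions])
       (use assms in \<open>auto simp: parts_in_def\<close>)
  also have "gf sum_mset (weight w) (add_mset k ` parts_in (insert k A)) =
      fps_const (w k) * fps_X ^ k * partition_gf w (insert k A)"
    unfolding partition_gf_def by (rule gf_shift) (auto simp: inj_on_def)
  finally show ?thesis by (rule geometric_fixpoint[OF assms(3)])
qed

lemma partition_gf_empty: "partition_gf w {} = 1"
proof -
  have "parts_in {} = {{#}}" by (auto simp: parts_in_def)
  then show ?thesis by (simp add: partition_gf_def gf_singleton)
qed

lemma partition_gf_union:
  assumes "A \<inter> B = {}" "0 \<notin> A" "0 \<notin> B"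
  shows "partition_gf w (A \<union> B) = partition_gf w A * partition_gf w B"
proof -
  have keep: "filter_mset P p = p" if "\<forall>x\<in>#p. P x" for P and p :: "nat multiset"
    using that by (simp add: filter_mset_eq_conv)
  have drop: "filter_mset P p = {#}" if "\<forall>x\<in>#p. \<not> P x" for P and p :: "nat multiset"
    using that by simp
  have "bij_betw (\<lambda>(p, q). p + q) (parts_in A \<times> parts_in B) (parts_in (A \<union> B))"
    by (rule bij_betw_byWitness[where f' = "\<lambda>p. (filter_mset (\<lambda>x. x \<in> A) p, filter_mset (\<lambda>x. x \<notin> A) p)"])
       (use assms in \<open>auto simp: parts_in_def keep drop subset_iff disjoint_iff intro!: keep\<close>)
  then have "gf sum_mset (weight w) (parts_in (A \<union> B)) =
      gf (\<lambda>(p, q). sum_mset p + sum_mset q) (\<lambda>(p, q). weight w p * weight w q) (parts_in A \<times> parts_in B)"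
    by (rule gf_bij) auto
  then show ?thesis
    unfolding partition_gf_def using gf_times[OF graded_parts_in graded_parts_in, OF assms(2,3)] by metis
qed

section \<open>Overpartitions\<close>

lemma mset_set_subseteq_mset:
  assumes "S \<subseteq> set_mset p"
  shows "mset_set S \<subseteq># p"
  by (rule mset_subset_eqI)
     (use assms finite_subset[OF assms] in \<open>auto simp: count_mset_set' Suc_le_eq\<close>)

text \<open>The overlined copies form a set S and the remaining parts an arbitrary partition. Two
  weights are kept because v = -w yields the inverse and v = w the overpartition series.\<close>

lemma partition_times_distinct:
  "partition_gf v {0<..} * distinct_gf w =
    gf (\<lambda>(p, S). sum_mset p) (\<lambda>(p, S). weight v (p - mset_set S) * prod w S)
      {(p, S). 0 \<notin># p \<and> S \<subseteq> set_mset p}" (is "_ = gf _ _ ?O")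
proof -
  have "bij_betw (\<lambda>(q, S). (q + mset_set S, S)) (partitions \<times> positive_sets) ?O"
    by (rule bij_betw_byWitness[where f' = "\<lambda>(p, S). (p - mset_set S, S)"])
       (auto simp: mset_set_subseteq_mset finite_subset dest: in_diffD)
  then have "gf (\<lambda>(p, S). sum_mset p) (\<lambda>(p, S). weight v (p - mset_set S) * prod w S) ?O =
      gf (\<lambda>(q, S). sum_mset q + \<Sum> S) (\<lambda>(q, S). weight v q * prod w S) (partitions \<times> positive_sets)"
    by (rule gf_bij) (auto simp: sum_unfold_sum_mset)
  then show ?thesis
    unfolding partition_gf_def distinct_gf_def
    using gf_times[OF graded_partitions graded_positive_sets, of "weight v" "prod w"]
    by (simp only: partitions_eq)
qed

text \<open>Expand the product of -1 + 1 over A.\<close>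

lemma sum_Pow_minus_one:
  assumes "finite A" "A \<noteq> {}"
  shows "(\<Sum>S\<in>Pow A. (-1) ^ card S) = (0::'a::comm_ring_1)"
  using prod_add[OF assms(1), of "\<lambda>_. -1 :: 'a" "\<lambda>_. 1"] assms
  by (simp add: zero_power card_gt_0_iff)

lemma weight_uminus: "weight (\<lambda>k. - w k) p = (-1) ^ size p * weight w p"
  by (induction p) auto

lemma weight_remove_set:
  assumes "S \<subseteq> set_mset p"
  shows "weight w (p - mset_set S) * prod w S = weight w p"
    and "size p = size (p - mset_set S) + card S"
proof -
  obtain q where p: "p = mset_set S + q"
    using mset_set_subseteq_mset[OF assms] by (metis mset_subset_eq_exists_conv)
  show "weight w (p - mset_set S) * prod w S = weight w p"
    by (simp add: p prod_unfold_prod_mset mult.commute)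
  show "size p = size (p - mset_set S) + card S"
    by (simp add: p)
qed

lemma overpartitions_of_Sigma:
  "{x \<in> {(p, S). 0 \<notin># p \<and> S \<subseteq> set_mset p}. (case x of (p, S) \<Rightarrow> sum_mset p) = n} =
    (SIGMA p:partitions_of n. Pow (set_mset p))"
  by (auto simp: partitions_of_def)

lemma partition_uminus_times_distinct:
  "partition_gf (\<lambda>k. - w k) {0<..} * distinct_gf w = 1"
proof (rule fps_ext)
  fix n
  have inner: "(\<Sum>S\<in>Pow (set_mset p). weight (\<lambda>k. - w k) (p - mset_set S) * prod w S) =
      (if p = {#} then 1 else 0)" for p
  proof -
    have "weight (\<lambda>k. - w k) (p - mset_set S) * prod w S =
        ((-1) ^ size p * weight w p) * (-1) ^ card S" if "S \<in> Pow (set_mset p)" for S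
    proof -
      have "S \<subseteq> set_mset p" using that by simp
      note r = weight_remove_set[OF this]
      \<comment> \<open>The sum and the difference of \<open>size p\<close> and
        \<open>card S\<close> have the same parity. Hence S enters the summand only through the sign
        (-1)^(card S).\<close>
      have e: "(-1) ^ size p * (-1) ^ card S = ((-1) ^ size (p - mset_set S) :: 'a)"
        unfolding r(2) by (simp add: power_add mult.assoc)
      then show ?thesis
        unfolding weight_uminus r(1)[of w, symmetric] e[symmetric] by (simp only: mult_ac)
    qed
    then have "(\<Sum>S\<in>Pow (set_mset p). weight (\<lambda>k. - w k) (p - mset_set S) * prod w S) =
        ((-1) ^ size p * weight w p) * (\<Sum>S\<in>Pow (set_mset p). (-1) ^ card S)"
      unfolding sum_distrib_left by (rule sum.cong[OF refl])
    then show ?thesis by (cases "p = {#}") (simp_all add: sum_Pow_minus_one)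
  qed
  have "(partition_gf (\<lambda>k. - w k) {0<..} * distinct_gf w) $ n =
      (\<Sum>p\<in>partitions_of n. \<Sum>S\<in>Pow (set_mset p). weight (\<lambda>k. - w k) (p - mset_set S) * prod w S)"
    unfolding partition_times_distinct gf_nth overpartitions_of_Sigma
    by (rule sum.Sigma[symmetric]) (simp_all add: finite_partitions_of)
  also have "\<dots> = (if {#} \<in> partitions_of n then 1 else 0)"
    unfolding inner using finite_partitions_of by (simp add: sum.delta)
  finally show "(partition_gf (\<lambda>k. - w k) {0<..} * distinct_gf w) $ n = 1 $ n"
    by (auto simp: partitions_of_def)
qed

abbreviation parity_weight :: "'a \<Rightarrow> 'a \<Rightarrow> nat \<Rightarrow> 'a::comm_ring_1" where
  "parity_weight y z \<equiv> \<lambda>k. if even k then y else z"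

lemma overpartition_series_eq:
  "overpartition_series y z =
    partition_gf (parity_weight y z) {0<..} * distinct_gf (parity_weight y z)"
proof (rule fps_ext)
  fix n
  have wt: "y ^ even_parts (p, S) * z ^ odd_parts (p, S) = weight (parity_weight y z) p" for p S
    by (induction p) (simp_all add: mult_ac)
  have eq: "overpartitions_of n = (SIGMA p:partitions_of n. Pow (set_mset p))"
    by (auto simp: overpartitions_of_def)
  have "overpartition_series y z $ n = (\<Sum>x\<in>overpartitions_of n. y ^ even_parts x * z ^ odd_parts x)"
    by (simp add: overpartition_series_def)
  also have "\<dots> = (\<Sum>(p, S)\<in>overpartitions_of n.
      weight (parity_weight y z) (p - mset_set S) * prod (parity_weight y z) S)"
  proof (rule sum.cong[OF refl], clarify)
    fix p S assume "(p, S) \<in> overpartitions_of n"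
    then have "S \<subseteq> set_mset p" by (simp add: overpartitions_of_def)
    then show "y ^ even_parts (p, S) * z ^ odd_parts (p, S) =
        weight (parity_weight y z) (p - mset_set S) * prod (parity_weight y z) S"
      by (simp only: wt weight_remove_set(1))
  qed
  finally show "overpartition_series y z $ n =
      (partition_gf (parity_weight y z) {0<..} * distinct_gf (parity_weight y z)) $ n"
    unfolding partition_times_distinct gf_nth overpartitions_of_Sigma eq .
qed

section \<open>Largest part and number of parts\<close>

text \<open>The inserted 0 gives the empty partition the value 0, matching the default of
  \<open>largest_repeated\<close>.\<close>

definition largest :: "nat multiset \<Rightarrow> nat" where
  "largest p = Max (insert 0 (set_mset p))"

text \<open>The series 1/((1 - q^2)(1 - q^4)...(1 - q^(2k))).\<close>

definition even_product :: "nat \<Rightarrow> 'a::comm_ring_1 fps" where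
  "even_product k = (\<Prod>i<k. geometric 1 (2 * i + 2))"

lemma double_bij: "bij_betw (image_mset ((*) 2)) (parts_in A) (parts_in ((*) 2 ` A))"
  unfolding bij_betw_def
proof
  show "inj_on (image_mset ((*) (2::nat))) (parts_in A)"
    by (rule inj_on_subset[OF multiset.inj_map]) (auto simp: inj_on_def)
  show "image_mset ((*) 2) ` parts_in A = parts_in ((*) 2 ` A)"
  proof (intro equalityI subsetI)
    fix p assume p: "p \<in> parts_in ((*) 2 ` A)"
    have "image_mset ((*) 2) (image_mset (\<lambda>x. x div 2) p) = image_mset (\<lambda>x. x) p"
      unfolding image_mset.compositionality
      by (rule image_mset_cong) (use p in \<open>auto simp: parts_in_def\<close>)
    then show "p \<in> image_mset ((*) 2) ` parts_in A"
      using p by (intro image_eqI[of _ _ "image_mset (\<lambda>x. x div 2) p"]) (auto simp: parts_in_def)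
  qed (auto simp: parts_in_def subset_iff)
qed

text \<open>Doubling every part turns the doubled size into the ordinary one. This serves the p in p
  + p + U, whose parts count twice.\<close>

lemma gf_double:
  "gf (\<lambda>p. 2 * sum_mset p) (\<lambda>p. weight (\<lambda>k. w (2 * k)) p) (parts_in A) = partition_gf w ((*) 2 ` A)"
proof -
  have "sum_mset (image_mset ((*) 2) p) = 2 * sum_mset p" for p :: "nat multiset"
    by (induction p) auto
  then show ?thesis
    unfolding partition_gf_def
    by (intro gf_bij[OF double_bij, symmetric])
       (simp_all add: image_mset.compositionality comp_def)
qed

lemma gf_parts_bounded:
  "gf (\<lambda>p. 2 * sum_mset p) (\<lambda>_. 1) (parts_in {1..k}) = (even_product k :: 'a::comm_ring_1 fps)"
proof -
  have "partition_gf (\<lambda>_. 1) ((*) 2 ` {1..k}) = (even_product k :: 'a fps)"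
  proof (induction k)
    case (Suc k)
    have "(*) 2 ` {1..Suc k} = insert (2 * k + 2) ((*) 2 ` {1..k})"
      by (simp add: atLeastAtMostSuc_conv)
    moreover have "partition_gf (\<lambda>_. 1) (insert (2 * k + 2) ((*) 2 ` {1..k})) =
        geometric 1 (2 * k + 2) * (partition_gf (\<lambda>_. 1) ((*) 2 ` {1..k}) :: 'a fps)"
      by (rule partition_gf_insert) auto
    ultimately have "partition_gf (\<lambda>_. 1) ((*) 2 ` {1..Suc k}) =
        geometric 1 (2 * k + 2) * (partition_gf (\<lambda>_. 1) ((*) 2 ` {1..k}) :: 'a fps)"
      by (simp only:)
    then show ?case by (simp only: Suc) (simp add: even_product_def mult.commute)
  qed (simp add: even_product_def partition_gf_empty)
  then show ?thesis using gf_double[of "\<lambda>_. 1 :: 'a"] by simp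
qed

text \<open>Parts equal to 0 are allowed here, so finiteness relies on the fixed number of
  parts.\<close>

lemma graded_size: "graded (\<lambda>p. 2 * sum_mset p) {p :: nat multiset. size p = k}"
  unfolding graded_def
proof
  fix n
  have "{p \<in> {p :: nat multiset. size p = k}. 2 * sum_mset p = n} \<subseteq>
      mset ` {xs. set xs \<subseteq> {..n} \<and> length xs = k}"
  proof
    fix p assume p: "p \<in> {p \<in> {p :: nat multiset. size p = k}. 2 * sum_mset p = n}"
    obtain xs where xs: "p = mset xs" using ex_mset by metis
    have "2 * sum_list xs = n" "length xs = k" using p by (auto simp: xs sum_mset_sum_list)
    then have "set xs \<subseteq> {..n}" using member_le_sum_list by fastforce
    then show "p \<in> mset ` {xs. set xs \<subseteq> {..n} \<and> length xs = k}" using xs \<open>length xs = k\<close> by blast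
  qed
  then show "finite {p \<in> {p :: nat multiset. size p = k}. 2 * sum_mset p = n}"
    by (rule finite_subset) (simp add: finite_lists_length_eq)
qed

lemma inj_image_Suc: "inj_on (image_mset Suc) A"
  by (rule inj_on_subset[OF multiset.inj_map]) auto

lemma image_Suc_size: "image_mset Suc ` {p. size p = k} = {p. 0 \<notin># p \<and> size p = k}"
proof (intro equalityI subsetI)
  fix p :: "nat multiset" assume p: "p \<in> {p. 0 \<notin># p \<and> size p = k}"
  have "image_mset Suc (image_mset (\<lambda>x. x - 1) p) = image_mset (\<lambda>x. x) p"
    unfolding image_mset.compositionality
    by (rule image_mset_cong) (use p in \<open>auto simp: gr0_conv_Suc intro!: Suc_pred gr0I\<close>)
  then show "p \<in> image_mset Suc ` {p. size p = k}"
    using p by (intro image_eqI[of _ _ "image_mset (\<lambda>x. x - 1) p"]) auto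
qed auto

lemma sum_image_Suc: "sum_mset (image_mset Suc p) = sum_mset p + size p"
  by (induction p) auto

text \<open>A multiset with k + 1 elements either contains a 0, which is removed at no cost, or all
  its elements can be lowered by 1 at the cost q^(2k + 2). The outcome agrees with
  \<open>gf_parts_bounded\<close>, which takes the place of conjugating diagrams.\<close>

lemma gf_size: "gf (\<lambda>p. 2 * sum_mset p) (\<lambda>_. 1) {p :: nat multiset. size p = k} = (even_product k :: 'a::comm_ring_1 fps)"
proof (induction k)
  case 0
  have "{p :: nat multiset. size p = 0} = {{#}}" by auto
  then show ?case by (simp add: gf_singleton even_product_def)
next
  case (Suc k)
  let ?gf = "gf (\<lambda>p :: nat multiset. 2 * sum_mset p) (\<lambda>_. 1 :: 'a)"
  let ?S = "\<lambda>k. {p :: nat multiset. size p = k}"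
  have eq: "?S (Suc k) = add_mset 0 ` ?S k \<union> image_mset Suc ` ?S (Suc k)"
  proof (intro equalityI subsetI)
    fix p assume p: "p \<in> ?S (Suc k)"
    show "p \<in> add_mset 0 ` ?S k \<union> image_mset Suc ` ?S (Suc k)"
    proof (cases "0 \<in># p")
      case True
      then obtain q where "p = add_mset 0 q" using multi_member_split by metis
      then show ?thesis using p by auto
    qed (use p in \<open>simp add: image_Suc_size\<close>)
  qed auto
  have "?gf (?S (Suc k)) = ?gf (add_mset 0 ` ?S k) + ?gf (image_mset Suc ` ?S (Suc k))"
  proof (subst eq, rule gf_union)
    show "add_mset 0 ` ?S k \<inter> image_mset Suc ` ?S (Suc k) = {}"
      unfolding image_Suc_size by auto
  qed (rule graded_subset[OF graded_size[of "Suc k"]], auto)+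
  also have "?gf (add_mset 0 ` ?S k) = fps_const 1 * fps_X ^ 0 * ?gf (?S k)"
    by (rule gf_shift) (auto simp: inj_on_def)
  also have "?gf (image_mset Suc ` ?S (Suc k)) = fps_const 1 * fps_X ^ (2 * k + 2) * ?gf (?S (Suc k))"
    by (rule gf_shift[OF inj_image_Suc]) (auto simp: sum_image_Suc)
  finally have "?gf (?S (Suc k)) = geometric 1 (2 * k + 2) * ?gf (?S k)"
    by (intro geometric_fixpoint) simp_all
  then show ?case by (simp only: Suc) (simp add: even_product_def mult.commute)
qed

lemma largest_Suc: "{p \<in> partitions. largest p = Suc k} = add_mset (Suc k) ` parts_in {1..Suc k}"
proof (intro equalityI subsetI)
  fix p assume p: "p \<in> {p \<in> partitions. largest p = Suc k}"
  have Max: "Suc k \<in> insert 0 (set_mset p)"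
    using Max_in[of "insert 0 (set_mset p)"] p by (simp add: largest_def)
  then obtain q where q: "p = add_mset (Suc k) q" using multi_member_split[of "Suc k" p] by auto
  have "x \<le> Suc k" if "x \<in># p" for x
    using p that Max_ge[of "insert 0 (set_mset p)" x] by (simp add: largest_def)
  moreover have "1 \<le> x" if "x \<in># p" for x
    using p that by (cases x) auto
  ultimately have "q \<in> parts_in {1..Suc k}"
    by (simp add: parts_in_def q subset_iff)
  then show "p \<in> add_mset (Suc k) ` parts_in {1..Suc k}"
    by (simp add: q)
next
  fix p assume "p \<in> add_mset (Suc k) ` parts_in {1..Suc k}"
  then obtain q where q: "p = add_mset (Suc k) q" "set_mset q \<subseteq> {1..Suc k}"
    by (auto simp: parts_in_def)
  have "largest p = Suc k"
    unfolding largest_def by (rule Max_eqI) (use q in auto)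
  moreover have "0 \<notin># p" using q by auto
  ultimately show "p \<in> {p \<in> partitions. largest p = Suc k}" by simp
qed

lemma largest_eq_0_iff: "0 \<notin># p \<Longrightarrow> largest p = 0 \<longleftrightarrow> p = {#}"
proof
  assume "0 \<notin># p" "largest p = 0"
  moreover have "x \<le> largest p" if "x \<in># p" for x
    using that unfolding largest_def by (auto intro!: Max_ge)
  ultimately show "p = {#}" by (metis le_zero_eq multiset_nonemptyE)
qed (simp add: largest_def)

text \<open>For each k both sides contribute y^k q^(2k) \<open>even_product k\<close>. With k parts,
  lower each of them by 1; with largest part k > 0, remove one copy of it, which leaves parts at
  most k.\<close>

lemma gf_largest_eq_gf_size:
  fixes y :: "'a::comm_ring_1"
  shows "gf (\<lambda>p. 2 * sum_mset p) (\<lambda>p. y ^ largest p) partitions =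
    gf (\<lambda>p. 2 * sum_mset p) (\<lambda>p. y ^ size p) partitions"
proof (rule gf_eq_by_index[OF graded_partitions_double graded_partitions_double])
  fix k
  have "{p \<in> partitions. size p = k} = image_mset Suc ` {p. size p = k}"
    by (auto simp: image_Suc_size)
  then have "gf (\<lambda>p. 2 * sum_mset p) (\<lambda>p. y ^ size p) {p \<in> partitions. size p = k} =
      fps_const (y ^ k) * fps_X ^ (2 * k) * gf (\<lambda>p. 2 * sum_mset p) (\<lambda>_. 1) {p :: nat multiset. size p = k}"
    by (simp only:) (rule gf_shift[OF inj_image_Suc], auto simp: sum_image_Suc)
  also have "\<dots> = fps_const (y ^ k) * fps_X ^ (2 * k) * even_product k"
    by (simp only: gf_size)
  also have "\<dots> = gf (\<lambda>p. 2 * sum_mset p) (\<lambda>p. y ^ largest p) {p \<in> partitions. largest p = k}"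
  proof (cases k)
    case 0
    have "{p \<in> partitions. largest p = 0} = {{#}}"
      using largest_eq_0_iff by auto
    then show ?thesis by (simp add: 0 gf_singleton even_product_def largest_def)
  next
    case (Suc j)
    have "gf (\<lambda>p. 2 * sum_mset p) (\<lambda>p. y ^ largest p) (add_mset (Suc j) ` parts_in {1..Suc j}) =
        fps_const (y ^ k) * fps_X ^ (2 * k) * gf (\<lambda>p. 2 * sum_mset p) (\<lambda>_. 1) (parts_in {1..Suc j})"
    proof (rule gf_shift)
      fix p assume "p \<in> parts_in {1..Suc j}"
      then have "largest (add_mset (Suc j) p) = k"
        using largest_Suc[of j] Suc by blast
      then show "y ^ largest (add_mset (Suc j) p) = y ^ k * 1" by simp
    qed (auto simp: inj_on_def Suc)
    then show ?thesis unfolding Suc largest_Suc gf_parts_bounded by simp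
  qed
  finally show "gf (\<lambda>p. 2 * sum_mset p) (\<lambda>p. y ^ largest p) {p \<in> partitions. largest p = k} =
    gf (\<lambda>p. 2 * sum_mset p) (\<lambda>p. y ^ size p) {p \<in> partitions. size p = k}" by simp
qed

lemma gf_largest:
  "gf (\<lambda>p. 2 * sum_mset p) (\<lambda>p. y ^ largest p) partitions =
    partition_gf (parity_weight y z) {k. even k \<and> k > 0}"
proof -
  have "weight (\<lambda>k. parity_weight y z (2 * k)) p = y ^ size p" for p :: "nat multiset"
    by (induction p) auto
  moreover have "(*) 2 ` {0<..} = {k :: nat. even k \<and> k > 0}"
    by (auto elim!: evenE)
  ultimately show ?thesis
    unfolding gf_largest_eq_gf_size using gf_double[of "parity_weight y z" "{0<..}"]
    by (simp only: partitions_eq)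
qed

section \<open>Alternating sums of finite sets\<close>

definition alternating_sum :: "nat list \<Rightarrow> int" where
  "alternating_sum xs = (\<Sum>i<length xs. (-1) ^ i * int (xs ! i))"

definition set_alternating_sum :: "nat set \<Rightarrow> nat" where
  "set_alternating_sum U = nat (alternating_sum (rev (sorted_list_of_set U)))"

lemma alternating_sum_Nil: "alternating_sum [] = 0"
  by (simp add: alternating_sum_def)

lemma alternating_sum_Cons: "alternating_sum (x # xs) = int x - alternating_sum xs"
  unfolding alternating_sum_def length_Cons sum.lessThan_Suc_shift by (simp add: sum_negf)

lemma alternating_sum_snoc_0: "alternating_sum (xs @ [0]) = alternating_sum xs"
  by (induction xs) (simp_all add: alternating_sum_Nil alternating_sum_Cons)

text \<open>The added ones carry alternating signs and cancel in pairs, leaving a 1 only for odd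
  length.\<close>

lemma alternating_sum_map_Suc: "alternating_sum (map Suc xs) = alternating_sum xs + int (length xs mod 2)"
proof (induction xs)
  case (Cons x xs)
  then show ?case by (auto simp: alternating_sum_Cons mod_Suc)
qed (simp add: alternating_sum_Nil)

lemma int_set_alternating_sum: "int (set_alternating_sum U) = alternating_sum (rev (sorted_list_of_set U))"
proof -
  have "sorted_wrt (\<ge>) (rev (sorted_list_of_set U))" by (simp add: sorted_wrt_rev)
  from alternating_sum_bounds[OF this] show ?thesis
    by (simp add: set_alternating_sum_def alternating_sum_def)
qed

lemma set_alternating_sum_insert_0:
  assumes "finite U" "0 \<notin> U"
  shows "set_alternating_sum (insert 0 U) = set_alternating_sum U"
proof -
  have "sorted_list_of_set (insert 0 U) = 0 # sorted_list_of_set U"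
    using assms by (simp add: insort_is_Cons)
  then have "int (set_alternating_sum (insert 0 U)) = int (set_alternating_sum U)"
    by (simp add: int_set_alternating_sum alternating_sum_snoc_0)
  then show ?thesis by simp
qed

lemma set_alternating_sum_Suc:
  assumes "finite U"
  shows "set_alternating_sum (Suc ` U) = set_alternating_sum U + card U mod 2"
proof -
  have "sorted_list_of_set (Suc ` U) = map Suc (sorted_list_of_set U)"
    by (rule sorted_distinct_set_unique) (use assms in \<open>auto simp: distinct_map sorted_map\<close>)
  then have "int (set_alternating_sum (Suc ` U)) = int (set_alternating_sum U + card U mod 2)"
    by (simp add: int_set_alternating_sum alternating_sum_map_Suc rev_map)
  then show ?thesis by simp
qed

lemma set_alternating_sum_empty: "set_alternating_sum {} = 0"
  by (simp add: set_alternating_sum_def alternating_sum_Nil)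

lemma sum_image_Suc_set: "finite V \<Longrightarrow> \<Sum> (Suc ` V) = \<Sum> V + card V"
  using sum_Suc[of "\<lambda>x. x" V] by (simp add: sum.reindex)

section \<open>Sets with a fixed number of elements\<close>

lemma set_containing_0_cases:
  fixes V :: "nat set"
  assumes "finite V"
  obtains W where "finite W" "card W = card V" "V = Suc ` W"
  | W where "finite W" "Suc (card W) = card V" "V = insert 0 (Suc ` W)"
proof -
  have Suc: "Suc ` (\<lambda>x. x - 1) ` W = W" if "0 \<notin> W" for W :: "nat set"
  proof -
    have "Suc (x - 1) = x" if "x \<in> W" for x using that \<open>0 \<notin> W\<close> by (cases x) auto
    then show ?thesis by (simp add: image_image)
  qed
  have card: "card ((\<lambda>x. x - 1) ` W) = card W" if "0 \<notin> W" for W :: "nat set"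
    using card_image[of Suc "(\<lambda>x. x - 1) ` W"] Suc[OF that] by simp
  show ?thesis
  proof (cases "0 \<in> V")
    case False
    show ?thesis
      by (rule that(1)[OF _ card[OF False] Suc[OF False, symmetric]]) (simp add: assms)
  next
    case True
    have 0: "0 \<notin> V - {0}" by simp
    show ?thesis
    proof (rule that(2))
      show "Suc (card ((\<lambda>x. x - 1) ` (V - {0}))) = card V"
        unfolding card[OF 0] using card.remove[OF assms True] by simp
      show "V = insert 0 (Suc ` (\<lambda>x. x - 1) ` (V - {0}))"
        unfolding Suc[OF 0] using True by auto
    qed (simp add: assms)
  qed
qed

text \<open>The series 1/((1 - z q)(1 - z q^3)...(1 - z q^(2k - 1))).\<close>

definition odd_product :: "'a \<Rightarrow> nat \<Rightarrow> 'a::comm_ring_1 fps" where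
  "odd_product z k = (\<Prod>i<k. geometric z (2 * i + 1))"

text \<open>The element 0 is allowed: it is what the recursion on l strips off, and later it
  completes sets of odd cardinality.\<close>

abbreviation card_gf :: "'a \<Rightarrow> nat \<Rightarrow> 'a::comm_ring_1 fps" where
  "card_gf z l \<equiv> gf \<Sum> (\<lambda>V. z ^ set_alternating_sum V) {V. finite V \<and> card V = l}"

lemma card_gf_0: "card_gf z 0 = 1"
proof -
  have "{V :: nat set. finite V \<and> card V = 0} = {{}}" by auto
  then show ?thesis by (simp add: gf_singleton set_alternating_sum_empty)
qed

text \<open>In a set with l + 1 elements, lower all elements by 1 if 0 is absent; otherwise remove 0
  and lower the other l. Lowering k elements costs q^k z^(k mod 2).\<close>

lemma card_gf_Suc:
  "card_gf z (Suc l) = geometric (z ^ (Suc l mod 2)) (Suc l) *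
    (fps_const (z ^ (l mod 2)) * fps_X ^ l * card_gf z l)"
proof (rule geometric_fixpoint)
  let ?S = "\<lambda>l. {V :: nat set. finite V \<and> card V = l}"
  let ?gf = "gf \<Sum> (\<lambda>V. z ^ set_alternating_sum V)"
  let ?f = "\<lambda>V. insert 0 (Suc ` V)"
  have inj: "inj_on ((`) Suc) A" for A
    by (rule inj_onI) (simp add: inj_image_eq_iff)
  have inj0: "inj_on ?f A" for A
  proof (rule inj_onI)
    fix V W assume "?f V = ?f W"
    then have "?f V - {0} = ?f W - {0}" by simp
    then have "Suc ` V = Suc ` W" by simp
    then show "V = W" by (simp add: inj_image_eq_iff)
  qed
  have graded: "graded \<Sum> T" if "T \<subseteq> {V. finite V}" for T :: "nat set set"
    by (rule graded_subset[OF graded_finite_sets that])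
  have "?S (Suc l) = ?f ` ?S l \<union> (`) Suc ` ?S (Suc l)"
  proof (intro equalityI subsetI)
    fix V assume V: "V \<in> ?S (Suc l)"
    then have "finite V" by simp
    then show "V \<in> ?f ` ?S l \<union> (`) Suc ` ?S (Suc l)"
      by (cases rule: set_containing_0_cases) (use V in auto)
  qed (auto simp: card_insert_if card_image)
  then have "?gf (?S (Suc l)) = ?gf (?f ` ?S l \<union> (`) Suc ` ?S (Suc l))" by (rule arg_cong)
  also have "\<dots> = ?gf (?f ` ?S l) + ?gf ((`) Suc ` ?S (Suc l))"
    by (rule gf_union; (rule graded)?) auto
  also have "?gf (?f ` ?S l) = fps_const (z ^ (l mod 2)) * fps_X ^ l * ?gf (?S l)"
    by (rule gf_shift[OF inj0])
       (auto simp: set_alternating_sum_insert_0 set_alternating_sum_Suc sum_image_Suc_set power_add)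
  also have "?gf ((`) Suc ` ?S (Suc l)) = fps_const (z ^ (Suc l mod 2)) * fps_X ^ Suc l * ?gf (?S (Suc l))"
    by (rule gf_shift[OF inj])
       (simp_all add: set_alternating_sum_Suc sum_image_Suc_set power_add)
  finally show "?gf (?S (Suc l)) = fps_const (z ^ (l mod 2)) * fps_X ^ l * ?gf (?S l) +
    fps_const (z ^ (Suc l mod 2)) * fps_X ^ Suc l * ?gf (?S (Suc l))" .
qed simp

section \<open>Durfee rectangles\<close>

text \<open>Counts the partitions into odd parts \<open>2c\<^sub>i - 1\<close> for which the largest rectangle of some shape
  \<open>m \<times> (m + j)\<close> inside the diagram of \<open>c\<close> has \<open>m\<close> rows: \<open>odd_product\<close> accounts for the parts
  below the rectangle and \<open>even_product\<close> for what lies to its right.\<close>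

definition durfee :: "'a \<Rightarrow> nat \<Rightarrow> nat \<Rightarrow> 'a::comm_ring_1 fps" where
  "durfee z j m = fps_const z ^ m * fps_X ^ (m * (2 * m + 2 * j - 1)) *
    odd_product z (m + j) * even_product m"

text \<open>The steps to 2m + 1 and to 2m + 2 elements together contribute z q^(4m + 1) / ((1 - z
  q^(2m + 1)) (1 - q^(2m + 2))), the ratio of consecutive Durfee terms.\<close>

lemma card_gf_even: "card_gf z (2 * m) = durfee z 0 m"
proof (induction m)
  case 0
  then show ?case by (simp add: card_gf_0 durfee_def odd_product_def even_product_def)
next
  case (Suc m)
  have exp: "Suc m * (2 * Suc m + 2 * 0 - 1) = m * (2 * m + 2 * 0 - 1) + 2 * m + (2 * m + 1)"
    by (cases m) (simp_all add: algebra_simps)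
  have "card_gf z (2 * Suc m) = geometric 1 (2 * m + 2) * (fps_const z * fps_X ^ (2 * m + 1) *
      (geometric z (2 * m + 1) * (fps_X ^ (2 * m) * card_gf z (2 * m))))"
    using card_gf_Suc[of z "Suc (2 * m)"] card_gf_Suc[of z "2 * m"] by simp
  then show ?case
    unfolding Suc durfee_def exp power_add odd_product_def even_product_def
    by (simp add: mult_ac del: fps_const_power fps_const_mult)
qed

text \<open>For m > 0 this is \<open>durfee z j m\<close> times 1 - q^(2m), cancelled against the
  last factor of \<open>even_product m\<close>. The value 0 at m = 0 continues that formula.\<close>

definition corner :: "'a \<Rightarrow> nat \<Rightarrow> nat \<Rightarrow> 'a::comm_ring_1 fps" where
  "corner z j m = (if m = 0 then 0 else fps_const z ^ m * fps_X ^ (m * (2 * m + 2 * j - 1)) *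
    odd_product z (m + j) * even_product (m - 1))"

text \<open>The difference of two consecutive widths telescopes in the number of rows.\<close>

lemma durfee_widen:
  fixes z :: "'a::comm_ring_1"
  shows "durfee z j m - durfee z (Suc j) m = corner z j m - corner z j (Suc m)"
proof -
  let ?d = "durfee z j m" and ?g = "geometric z (2 * (m + j) + 1)"
  have exp: "m * (2 * m + 2 * Suc j - 1) = m * (2 * m + 2 * j - 1) + 2 * m"
    "Suc m * (2 * Suc m + 2 * j - 1) = m * (2 * m + 2 * j - 1) + 2 * m + (2 * (m + j) + 1)"
    by (cases m; simp add: algebra_simps)+
  \<comment> \<open>Write d and g for \<open>?d\<close> and \<open>?g\<close>, and x for q^(2m).
    Then \<open>wide\<close>, \<open>upper\<close> and \<open>lower\<close> become d x g, d x (g -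
    1) and d (1 - x), and both sides of the claim equal d - d x g.\<close>
  have g: "fps_const z * fps_X ^ (2 * (m + j) + 1) * ?g = ?g - 1"
    using geometric[of "2 * (m + j) + 1" z] by (simp add: algebra_simps)
  have wide: "durfee z (Suc j) m = ?d * fps_X ^ (2 * m) * ?g"
    unfolding durfee_def exp power_add odd_product_def by (simp add: mult_ac del: fps_const_power fps_const_mult)
  have upper: "corner z j (Suc m) = ?d * fps_X ^ (2 * m) * (fps_const z * fps_X ^ (2 * (m + j) + 1) * ?g)"
    unfolding corner_def durfee_def exp power_add odd_product_def by (simp add: mult_ac del: fps_const_power fps_const_mult)
  have lower: "corner z j m = ?d * (1 - fps_X ^ (2 * m))"
  proof (cases m)
    case (Suc k)
    have "geometric (1::'a) (2 * k + 2) * (1 - fps_X ^ (2 * k + 2)) = 1"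
      using geometric[of "2 * k + 2" "1::'a"] by (simp add: mult.commute)
    moreover have "?d = corner z j m * geometric 1 (2 * k + 2)"
      unfolding corner_def durfee_def by (simp add: Suc even_product_def mult_ac del: fps_const_power fps_const_mult)
    ultimately show ?thesis by (simp add: Suc mult.assoc)
  qed (simp add: corner_def)
  show ?thesis unfolding wide upper lower g by (simp add: algebra_simps)
qed

text \<open>By telescoping, passing from width j to j + 1 adds just \<open>corner z j n\<close> to
  the sum, and this is divisible by q^n.\<close>

lemma durfee_sum_widen: "fps_X ^ n dvd (\<Sum>m<n. durfee z 0 m) - (\<Sum>m<n. durfee z j m)"
proof (induction j)
  case (Suc j)
  have "n \<le> n * (2 * n + 2 * j - 1)" if "n > 0" using that by simp
  then have "n = 0 \<or> fps_X ^ n dvd (fps_X ^ (n * (2 * n + 2 * j - 1)) :: 'a fps)"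
    by (meson le_imp_power_dvd not_gr0)
  then have "fps_X ^ n dvd (\<Sum>m<n. durfee z j m - durfee z (Suc j) m)"
    unfolding durfee_widen sum_lessThan_telescope' by (auto simp: corner_def)
  then have "fps_X ^ n dvd (\<Sum>m<n. durfee z j m) - (\<Sum>m<n. durfee z (Suc j) m)"
    by (simp add: sum_subtractf)
  from dvd_add[OF Suc this] show ?case by simp
qed simp

section \<open>Letting the rectangles become wide\<close>

lemma fps_X_power_dvd_nth:
  fixes f g :: "'a::comm_ring_1 fps"
  assumes "fps_X ^ n dvd f - g" "i < n"
  shows "f $ i = g $ i"
proof -
  obtain h where "f - g = fps_X ^ n * h" using assms(1) by blast
  then have "(f - g) $ i = 0" using assms(2) by (simp add: fps_X_power_mult_nth)
  then show ?thesis by simp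
qed

text \<open>The width j = n realizes the limit to the precision wanted: modulo q^n every term with m
  > 0 vanishes, and the term m = 0 is \<open>odd_product z n\<close>.\<close>

lemma durfee_sum_nth:
  assumes "i < n"
  shows "(\<Sum>m<n. durfee z 0 m) $ i = odd_product z n $ i"
proof -
  have "fps_X ^ n dvd durfee z n m - (if m = 0 then odd_product z n else 0)" if "m < n" for m
  proof (cases m)
    case (Suc k)
    have "n \<le> m * (2 * m + 2 * n - 1)" using Suc by simp
    then show ?thesis
      unfolding durfee_def using Suc by (simp add: le_imp_power_dvd)
  qed (simp add: durfee_def even_product_def)
  then have "fps_X ^ n dvd (\<Sum>m<n. durfee z n m - (if m = 0 then odd_product z n else 0))"
    by (intro dvd_sum) auto
  then have "fps_X ^ n dvd (\<Sum>m<n. durfee z n m) - odd_product z n"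
    using assms by (simp add: sum_subtractf)
  from dvd_add[OF durfee_sum_widen[of n z n] this]
  have "fps_X ^ n dvd (\<Sum>m<n. durfee z 0 m) - odd_product z n" by simp
  then show ?thesis using assms by (rule fps_X_power_dvd_nth)
qed

lemma odd_product_eq: "odd_product z n = partition_gf (parity_weight y z) {k. odd k \<and> k < 2 * n}"
proof (induction n)
  case 0
  then show ?case by (simp add: odd_product_def partition_gf_empty)
next
  case (Suc n)
  have "{k. odd k \<and> k < 2 * Suc n} = insert (2 * n + 1) {k. odd k \<and> k < 2 * n}"
    by (auto simp: less_Suc_eq)
  moreover have "partition_gf (parity_weight y z) (insert (2 * n + 1) {k. odd k \<and> k < 2 * n}) =
      geometric (parity_weight y z (2 * n + 1)) (2 * n + 1) *
      partition_gf (parity_weight y z) {k. odd k \<and> k < 2 * n}"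
    by (rule partition_gf_insert) auto
  ultimately have "partition_gf (parity_weight y z) {k. odd k \<and> k < 2 * Suc n} =
      geometric (parity_weight y z (2 * n + 1)) (2 * n + 1) * odd_product z n"
    by (simp only: Suc)
  then show ?case by (simp add: odd_product_def mult.commute)
qed

text \<open>A partition of i has parts at most i < n, so the bound 2n excludes nothing.\<close>

lemma odd_product_nth:
  assumes "i < n"
  shows "odd_product z n $ i = partition_gf (parity_weight y z) {k. odd k} $ i"
proof -
  have le: "x \<le> sum_mset p" if "x \<in># p" for x and p :: "nat multiset"
  proof -
    obtain q where "p = add_mset x q" using multi_member_split[OF \<open>x \<in># p\<close>] by auto
    then show ?thesis by simp
  qed
  have "x < 2 * n" if "sum_mset p = i" "x \<in># p" for p x
    using le[OF that(2)] that(1) assms by simp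
  then have "{p \<in> parts_in {k. odd k \<and> k < 2 * n}. sum_mset p = i} =
      {p \<in> parts_in {k. odd k}. sum_mset p = i}"
    by (auto simp: parts_in_def subset_iff)
  then show ?thesis unfolding odd_product_eq[of z n y] partition_gf_def gf_nth by simp
qed

text \<open>A set of positive numbers of odd size is completed to even size by the element \<open>0\<close>, which
  changes neither its sum nor its alternating sum.\<close>

lemma gf_positive_sets_index:
  "gf \<Sum> (\<lambda>U. z ^ set_alternating_sum U) {U \<in> positive_sets. (card U + 1) div 2 = m} =
    card_gf z (2 * m)"
proof (rule gf_bij)
  \<comment> \<open>For m > 0 the index m collects the sets with 2m - 1 or 2m elements; the parity
    of \<open>card U\<close> tells whether a 0 was deleted.\<close>
  show "bij_betw (\<lambda>V. V - {0}) {V. finite V \<and> card V = 2 * m}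
      {U \<in> positive_sets. (card U + 1) div 2 = m}"
    by (rule bij_betw_byWitness[where f' = "\<lambda>U. if even (card U) then U else insert 0 U"])
       (auto simp: card_Diff_singleton_if insert_absorb elim!: oddE evenE, presburger+)
next
  fix V :: "nat set" assume "V \<in> {V. finite V \<and> card V = 2 * m}"
  then have "finite V" by simp
  then show "\<Sum> (V - {0}) = \<Sum> V" by (simp add: sum_diff1_nat)
  show "z ^ set_alternating_sum (V - {0}) = z ^ set_alternating_sum V"
    using set_alternating_sum_insert_0[of "V - {0}"] \<open>finite V\<close> by (cases "0 \<in> V") (auto simp: insert_absorb)
qed

lemma card_le_sum: "finite U \<Longrightarrow> 0 \<notin> U \<Longrightarrow> card U \<le> \<Sum> U"
  using sum_mono[of U "\<lambda>_. 1" "\<lambda>x. x"] by (auto simp: Suc_le_eq intro: gr0I)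

lemma gf_alternating_sum:
  "gf \<Sum> (\<lambda>U. z ^ set_alternating_sum U) positive_sets =
    partition_gf (parity_weight y z) {k. odd k}"
proof (rule fps_ext)
  fix n
  \<comment> \<open>The cardinality is at most the sum n, so indices below n + 1 suffice, and
    precision n + 1 determines the coefficient at n.\<close>
  have "(card U + 1) div 2 \<in> {..<Suc n}" if "U \<in> positive_sets" "\<Sum> U = n" for U
    using card_le_sum[of U] that by auto
  then have "gf \<Sum> (\<lambda>U. z ^ set_alternating_sum U) positive_sets $ n = (\<Sum>m<Suc n. durfee z 0 m $ n)"
    by (subst gf_nth_by_index[OF graded_positive_sets, of "{..<Suc n}" n "\<lambda>U. (card U + 1) div 2"])
       (simp_all only: finite_lessThan gf_positive_sets_index card_gf_even)
  also have "\<dots> = odd_product z (Suc n) $ n"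
    by (simp only: durfee_sum_nth lessI flip: fps_sum_nth)
  finally show "gf \<Sum> (\<lambda>U. z ^ set_alternating_sum U) positive_sets $ n =
      partition_gf (parity_weight y z) {k. odd k} $ n"
    by (simp only: odd_product_nth[of n "Suc n" z y] lessI)
qed

section \<open>Pairing equal parts\<close>

lemma count_pairing:
  "finite U \<Longrightarrow> count (p + p + mset_set U) x = 2 * count p x + (if x \<in> U then 1 else 0)"
  by (simp add: count_mset_set')

text \<open>Divide each multiplicity by 2: the quotients are the multiplicities in p, and the
  remainders 1 mark the elements of U.\<close>

lemma pairing_bij:
  "bij_betw (\<lambda>(p, U). p + p + mset_set U) (partitions \<times> positive_sets) partitions"
  unfolding bij_betw_def
proof
  show "inj_on (\<lambda>(p, U). p + p + mset_set U) (partitions \<times> positive_sets)"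
  proof (rule inj_onI, clarify)
    fix p q :: "nat multiset" and U W :: "nat set"
    assume fin: "finite U" "finite W" and eq: "p + p + mset_set U = q + q + mset_set W"
    have "count p x = count q x \<and> (x \<in> U \<longleftrightarrow> x \<in> W)" for x
    proof -
      have "2 * count p x + (if x \<in> U then 1 else 0) = 2 * count q x + (if x \<in> W then 1 else 0)"
        using count_pairing[OF fin(1)] count_pairing[OF fin(2)] eq by metis
      then show ?thesis by (auto split: if_splits; presburger)
    qed
    then show "p = q \<and> U = W" by (auto intro: multiset_eqI)
  qed
  show "(\<lambda>(p, U). p + p + mset_set U) ` (partitions \<times> positive_sets) = partitions"
  proof (intro equalityI subsetI)
    fix p :: "nat multiset" assume "p \<in> partitions"
    then have p: "count p 0 = 0" by (simp add: not_in_iff)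
    define U where "U = {k. odd (count p k)}"
    define q where "q = Abs_multiset (\<lambda>x. count p x div 2)"
    have "finite {x. 0 < count p x div 2}"
      by (rule finite_subset[of _ "set_mset p"]) (auto simp: not_in_iff intro: ccontr)
    then have q: "count q x = count p x div 2" for x
      unfolding q_def by simp
    have U: "finite U" unfolding U_def by (rule finite_unpaired)
    have "p = q + q + mset_set U"
      by (rule multiset_eqI, subst count_pairing[OF U]) (auto simp: q U_def)
    moreover have "0 \<notin># q" "0 \<notin> U" using p by (auto simp: U_def q not_in_iff)
    ultimately show "p \<in> (\<lambda>(p, U). p + p + mset_set U) ` (partitions \<times> positive_sets)"
      using U by (intro image_eqI[of _ _ "(q, U)"]) auto
  qed (auto simp: not_in_iff)
qed

text \<open>A multiplicity 2c or 2c + 1 is at least 2 exactly when c > 0, so the repeated parts are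
  the parts of p.\<close>

lemma largest_repeated_pairing:
  assumes "finite U" "0 \<notin># p"
  shows "largest_repeated (p + p + mset_set U) = largest p"
proof -
  have "{k. count (p + p + mset_set U) k \<ge> 2} = set_mset p"
    unfolding count_pairing[OF assms(1)] by (auto simp: not_in_iff Suc_le_eq split: if_splits)
  moreover have "(\<exists>k. count (p + p + mset_set U) k \<ge> 2) \<longleftrightarrow> p \<noteq> {#}"
    using calculation by (metis (mono_tags, lifting) empty_Collect_eq set_mset_eq_empty_iff)
  moreover have "largest p = (if p = {#} then 0 else Max (set_mset p))"
    by (simp add: largest_def)
  ultimately show ?thesis unfolding largest_repeated_def by simp
qed

lemma alternating_unpaired_pairing:
  assumes "finite U"
  shows "alternating_unpaired (p + p + mset_set U) = set_alternating_sum U"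
proof -
  have "{k. odd (count (p + p + mset_set U) k)} = U"
    unfolding count_pairing[OF assms] by auto
  then show ?thesis
    unfolding alternating_unpaired_def set_alternating_sum_def unpaired_parts_def alternating_sum_def
    by (simp only:)
qed

lemma J_series_eq: "J_series y z = partition_gf (parity_weight y z) {0<..}"
proof -
  have "J_series y z = gf sum_mset (\<lambda>p. y ^ largest_repeated p * z ^ alternating_unpaired p) partitions"
    by (simp add: J_series_def gf_def partitions_of_eq)
  also have "\<dots> = gf (\<lambda>(p, U). 2 * sum_mset p + \<Sum> U)
      (\<lambda>(p, U). y ^ largest p * z ^ set_alternating_sum U) (partitions \<times> positive_sets)"
    by (rule gf_bij[OF pairing_bij])
       (auto simp: largest_repeated_pairing alternating_unpaired_pairing sum_unfold_sum_mset
         simp flip: mult_2)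
  also have "\<dots> = gf (\<lambda>p. 2 * sum_mset p) (\<lambda>p. y ^ largest p) partitions *
      gf \<Sum> (\<lambda>U. z ^ set_alternating_sum U) positive_sets"
    by (rule gf_times[OF graded_partitions_double graded_positive_sets, symmetric])
  also have "\<dots> = partition_gf (parity_weight y z) {k. even k \<and> k > 0} *
      partition_gf (parity_weight y z) {k. odd k}"
    by (simp only: gf_largest[of y z] gf_alternating_sum[of z y])
  also have "\<dots> = partition_gf (parity_weight y z) ({k. even k \<and> k > 0} \<union> {k. odd k})"
    by (rule partition_gf_union[symmetric]) auto
  also have "{k. even k \<and> k > 0} \<union> {k. odd k} = {0 :: nat<..}"
    by (auto simp: odd_pos)
  finally show ?thesis .
qed

theorem theorem5p1:
  shows "\<exists>I :: int poly poly fps. J_series (- Y_var) (- Z_var) * I = 1 \<and>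
    overpartition_series Y_var Z_var = J_series Y_var Z_var * I"
proof (intro exI conjI)
  let ?w = "parity_weight Y_var Z_var"
  \<comment> \<open>Negating both variables negates the weight of every part, so the inverse of the
    denominator is \<open>distinct_gf\<close> of the original weight.\<close>
  have "parity_weight (- Y_var) (- Z_var) = (\<lambda>k. - ?w k)" by auto
  then show "J_series (- Y_var) (- Z_var) * distinct_gf ?w = 1"
    unfolding J_series_eq by (simp only: partition_uminus_times_distinct)
  show "overpartition_series Y_var Z_var = J_series Y_var Z_var * distinct_gf ?w"
    unfolding J_series_eq by (rule overpartition_series_eq)
qed

end
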